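(* Let $A=\sqrt{(x^2+qs)\eta^2}$ be the symbolic square root of the linear operator $(x^2+qs)\eta^2$ and let $p_n(x,A)=(x+A)(qx+A)\cdots(q^{n-1}x+A)$. Then for all integers $n\ge 0$ $$T_n(x,s,q)=\frac{p_n(x,A)+p_n(x,-A)}{2}\,1=\sum_{k=0}^{\lfloor n/2\rfloor}q^{\binom{n-2k}{2}}\begin{bmatrix} n\\2k\end{bmatrix}x^{n-2k}\prod_{j=0}^{k-1}\left(x^2+q^{2j+1}s\right)$$ and $$U_n(x,s,q)=\frac{p_{n+1}(x,A)-p_{n+1}(x,-A)}{2A}\,1=\sum_{k=0}^{\lfloor (n+1)/2\rfloor}q^{\binom{n-2k}{2}}\begin{bmatrix} n+1\\2k+1\end{bmatrix}x^{n-2k}\prod_{j=0}^{k-1}\left(x^2+q^{2j+1}s\right).$$ Equivalently, in symbolic form, $p_n(x,A)=T_n(x,s,q)+U_{n-1}(x,s,q)\,A$.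
   Context: Here $x,s,q$ are indeterminates. Notation: $(a;q)_n=\prod_{j=0}^{n-1}(1-q^ja)$; $\begin{bmatrix} n\\k\end{bmatrix}=\frac{(q;q)_n}{(q;q)_k(q;q)_{n-k}}$ for $0\le k\le n$ and $\begin{bmatrix} n\\k\end{bmatrix}=0$ for $k>n$ (terms with a vanishing $q$-binomial coefficient are $0$); $[n]=\frac{1-q^n}{1-q}$; $\binom m2=\frac{m(m-1)}2$ for every integer $m$. The linear operator $\eta$ acts on polynomials in $x,s$ by $\eta f(x,s)=f(x,qs)$. Meaning of the symbolic expressions: $A$ is a formal symbol commuting with $x$ and $q$, and $A^2$ is identified with the operator $f(x,s)\mapsto (x^2+qs)f(x,q^2s)$. The polynomials $\frac{p_n(x,A)+p_n(x,-A)}2$ and $\frac{p_{n+1}(x,A)-p_{n+1}(x,-A)}{2A}$ are polynomials in $A^2$ with coefficients (written on the left) in $\mathbb{Z}[q][x]$, hence are linear operators, and "$\,1$" means that they are applied to the constant polynomial $1$. The identity $p_n(x,A)=T_n+U_{n-1}A$ means that $T_n$ is the even part of $p_n(x,A)$ in $A$ applied to $1$, and $U_{n-1}$ is the odd part divided by $A$ applied to $1$. The $q$-Chebyshev polynomials of the second kind are $U_{-1}(x,s,q)=0$ and, for $n\ge0$, $$U_n(x,s,q)=\sum_{k=0}^{\lfloor n/2\rfloor}q^{k^2}\begin{bmatrix} n-k\\k\end{bmatrix}(1+q^{k+1})\cdots(1+q^{n-k})\,s^kx^{n-2k}.$$ The $q$-Chebyshev polynomials of the first kind are $T_0(x,s,q)=1$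 and, for $n>0$, $$T_n(x,s,q)=\sum_{k=0}^{\lfloor n/2\rfloor}q^{k^2}\frac{[n]}{[n-k]}\begin{bmatrix} n-k\\k\end{bmatrix}\frac{(-q;q)_{n-1}}{(-q;q)_k\,(-q^{n-k};q)_k}\,s^kx^{n-2k}.$$ *)

theory Defs
  imports "HOL-Computational_Algebra.Computational_Algebra"
begin

text \<open>
  Coefficients live in the fraction field of \<open>\<int>[q]\<close>, since the defining formulas of the
  \<open>q\<close>-binomial coefficients and of \<open>T\<^sub>n\<close> contain quotients.
\<close>

type_synonym qfun = "int poly fract"

text \<open>
  \<open>xs_poly\<close> is \<open>K[x][s]\<close> (inner variable \<open>x\<close>, outer variable \<open>s\<close>) and
  \<open>xA_poly\<close> is \<open>K[x][A]\<close> (inner variable \<open>x\<close>, outer variable the formal symbol \<open>A\<close>), where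
  \<open>K = qfun\<close>. The underlying types coincide, but the roles of the outer variable differ.
\<close>

type_synonym xs_poly = "qfun poly poly"
type_synonym xA_poly = "qfun poly poly"

definition qv :: qfun where "qv = Fract [:0, 1:] 1"

definition xv :: xs_poly where "xv = [:[:0, 1:]:]"

definition sv :: xs_poly where "sv = [:0, 1:]"

definition cst :: "qfun \<Rightarrow> xs_poly" where "cst c = [:[:c:]:]"

definition Av :: xA_poly where "Av = [:0, 1:]"

definition qpoch :: "qfun \<Rightarrow> nat \<Rightarrow> qfun" where
  "qpoch a n = (\<Prod>j<n. 1 - qv ^ j * a)"

definition qbinom :: "nat \<Rightarrow> nat \<Rightarrow> qfun" where
  "qbinom n k = (if k \<le> n then qpoch qv n / (qpoch qv k * qpoch qv (n - k)) else 0)"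

definition qbracket :: "nat \<Rightarrow> qfun" where
  "qbracket n = (1 - qv ^ n) / (1 - qv)"

text \<open>\<open>m (m - 1) / 2\<close> is a nonnegative integer for every integer \<open>m\<close>, so \<open>nat\<close> loses nothing.\<close>

definition binom2 :: "int \<Rightarrow> nat" where
  "binom2 m = nat (m * (m - 1) div 2)"

definition chebT :: "nat \<Rightarrow> xs_poly" where
  "chebT n = (if n = 0 then 1 else
     (\<Sum>k = 0..n div 2.
        cst (qv ^ (k\<^sup>2) * (qbracket n / qbracket (n - k)) * qbinom (n - k) k *
             (qpoch (- qv) (n - 1) / (qpoch (- qv) k * qpoch (- (qv ^ (n - k))) k)))
        * sv ^ k * xv ^ (n - 2 * k)))"

text \<open>
  The index is an integer because \<open>U\<^sub>-\<^sub>1 = 0\<close> is needed; the value at indices below \<open>-1\<close> is a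
  dummy.
\<close>

definition chebU :: "int \<Rightarrow> xs_poly" where
  "chebU m = (if m < 0 then 0 else
     (let n = nat m in
      \<Sum>k = 0..n div 2.
        cst (qv ^ (k\<^sup>2) * qbinom (n - k) k * (\<Prod>j = k + 1..n - k. 1 + qv ^ j))
        * sv ^ k * xv ^ (n - 2 * k)))"

definition eta :: "xs_poly \<Rightarrow> xs_poly" where
  "eta f = pcompose f (cst qv * sv)"

text \<open>The operator \<open>(x\<^sup>2 + q s) \<eta>\<^sup>2\<close>, with which \<open>A\<^sup>2\<close> is identified.\<close>

definition Asq_op :: "xs_poly \<Rightarrow> xs_poly" where
  "Asq_op f = (xv\<^sup>2 + cst qv * sv) * eta (eta f)"

text \<open>
  For \<open>r = \<Sum>\<^sub>i r\<^sub>i(x) Y\<^sup>i\<close>, viewed as a polynomial in \<open>Y = A\<^sup>2\<close>, the linear operator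
  \<open>\<Sum>\<^sub>i r\<^sub>i(x) ((x\<^sup>2 + q s) \<eta>\<^sup>2)\<^sup>i\<close>, with the coefficients on the left.
\<close>

definition op_of :: "xA_poly \<Rightarrow> xs_poly \<Rightarrow> xs_poly" where
  "op_of r f = (\<Sum>i\<le>degree r. smult (coeff r i) ((Asq_op ^^ i) f))"

text \<open>
  \<open>in_Asq P\<close> is the polynomial \<open>r\<close> with \<open>P(A) = r(A\<^sup>2)\<close>; it exists and is unique if
  \<open>P(-A) = P(A)\<close>, see \<open>in_Asq_unique\<close> below.
\<close>

definition in_Asq :: "xA_poly \<Rightarrow> xA_poly" where
  "in_Asq P = (THE r. pcompose r (Av\<^sup>2) = P)"

definition p_A :: "nat \<Rightarrow> xA_poly" where
  "p_A n = (\<Prod>j<n. [:smult (qv ^ j) [:0, 1:]:] + Av)"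

definition negA :: "xA_poly \<Rightarrow> xA_poly" where
  "negA P = pcompose P (- Av)"

text \<open>
  In the next two definitions \<open>div\<close> is exact division in \<open>K[x][A]\<close> (see
  \<open>even_part_exact\<close> and \<open>odd_part_exact\<close>).
\<close>

definition even_part :: "xA_poly \<Rightarrow> xA_poly" where
  "even_part P = (P + negA P) div 2"

definition odd_part_over_A :: "xA_poly \<Rightarrow> xA_poly" where
  "odd_part_over_A P = (P - negA P) div (2 * Av)"

text \<open>
  \<open>symbolic_eq P T U\<close> is the symbolic identity \<open>P(A) = T + U A\<close>: writing
  \<open>P(A) = e(A\<^sup>2) + d(A\<^sup>2) A\<close>, one has \<open>T = e(A\<^sup>2) 1\<close> and \<open>U = d(A\<^sup>2) 1\<close>.
\<close>

definition symbolic_eq :: "xA_poly \<Rightarrow> xs_poly \<Rightarrow> xs_poly \<Rightarrow> bool" where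
  "symbolic_eq P T U \<longleftrightarrow>
     (\<exists>e d. P = pcompose e (Av\<^sup>2) + pcompose d (Av\<^sup>2) * Av \<and> T = op_of e 1 \<and> U = op_of d 1)"

lemma Av_sq: "Av\<^sup>2 = [:0, 0, 1:]"
  by (simp add: Av_def power2_eq_square)

lemma coeff_pcompose_Asq:
  "coeff (pcompose r (Av\<^sup>2)) i = (if even i then coeff r (i div 2) else 0)"
proof (induction r arbitrary: i)
  case 0
  then show ?case by simp
next
  case (pCons a r)
  have "coeff (pcompose (pCons a r) (Av\<^sup>2)) i
      = coeff (pCons a (pCons 0 (pcompose r (Av\<^sup>2)))) i"
    by (simp add: pcompose_pCons Av_sq)
  then show ?case
    by (auto simp: coeff_pCons pCons.IH split: nat.split)
qed

lemma coeff_negA: "coeff (negA P) i = (- 1) ^ i * coeff P i"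
proof -
  have "coeff (negA P) i = coeff (pcompose P [:0, - 1:]) i"
    by (simp add: negA_def Av_def)
  then show ?thesis
    by (simp add: coeff_pcompose_linear)
qed

lemma in_Asq_unique:
  assumes "negA P = P"
  shows "\<exists>!r. pcompose r (Av\<^sup>2) = P"
proof (rule ex_ex1I)
  have odd0: "coeff P i = 0" if "odd i" for i
  proof -
    have "coeff P i = - coeff P i"
      using coeff_negA[of P i] assms that by simp
    then show ?thesis
      by (simp add: poly_eq_iff eq_neg_iff_add_eq_0 mult_2[symmetric])
  qed
  have "\<forall>\<^sub>\<infinity>i. coeff P (2 * i) = 0"
    by (metis (mono_tags, lifting) MOST_nat coeff_eq_0 less_le_trans mult_2 le_add1)
  then have "coeff (Abs_poly (\<lambda>i. coeff P (2 * i))) = (\<lambda>i. coeff P (2 * i))"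
    by (rule Abs_poly_inverse[OF CollectI])
  then have "pcompose (Abs_poly (\<lambda>i. coeff P (2 * i))) (Av\<^sup>2) = P"
    by (intro poly_eqI) (auto simp: coeff_pcompose_Asq odd0)
  then show "\<exists>r. pcompose r (Av\<^sup>2) = P" ..
next
  fix r r'
  assume "pcompose r (Av\<^sup>2) = P" "pcompose r' (Av\<^sup>2) = P"
  then have "coeff (pcompose r (Av\<^sup>2)) (2 * i) = coeff (pcompose r' (Av\<^sup>2)) (2 * i)" for i
    by simp
  then show "r = r'"
    by (intro poly_eqI) (simp add: coeff_pcompose_Asq)
qed

lemma two_eq_const: "(2 :: xA_poly) = [:[:2:]:]"
  by (simp add: numeral_poly)

lemma two_dvd: "(2 :: xA_poly) dvd P"
proof -
  have "P = 2 * smult [:1/2:] P"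
    by (simp add: two_eq_const flip: one_pCons)
  then show ?thesis
    by (rule dvdI)
qed

lemma even_part_exact: "2 * even_part P = P + negA P"
  unfolding even_part_def using two_dvd by (rule dvd_mult_div_cancel)

lemma odd_part_exact: "2 * Av * odd_part_over_A P = P - negA P"
proof -
  have R0: "coeff (P - negA P) 0 = 0"
    by (simp only: coeff_diff coeff_negA power_0 mult_1 diff_self)
  obtain a R where R: "P - negA P = pCons a R"
    by (rule pCons_cases)
  have a: "a = 0"
    using R0 by (simp only: R coeff_pCons_0)
  obtain S where S: "R = 2 * S"
    using two_dvd by (rule dvdE)
  have Av_mult: "Av * Q = pCons 0 Q" for Q
    by (simp add: Av_def)
  have "P - negA P = 2 * Av * S"
    by (simp only: R a S mult.assoc mult.left_commute[of 2 Av] flip: Av_mult)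
  then have "2 * Av dvd P - negA P"
    by (rule dvdI)
  then show ?thesis
    unfolding odd_part_over_A_def by (rule dvd_mult_div_cancel)
qed

lemma coeff_two_mult: "coeff (2 * P :: xA_poly) i = 2 * coeff P i"
  by (simp only: mult_2 coeff_add)

lemma coeff_Av_mult: "coeff (Av * P) (Suc i) = coeff P i"
  by (simp add: Av_def)

lemma negA_of_coeff:
  assumes "\<And>i. 2 * coeff Q i = (1 + (- 1) ^ i) * c i"
  shows "negA Q = Q"
proof (rule poly_eqI)
  fix i
  show "coeff (negA Q) i = coeff Q i"
  proof (cases "even i")
    case True
    then show ?thesis
      by (simp only: coeff_negA power_minus_even power_one mult_1)
  next
    case False
    have "(- 1 :: qfun poly) ^ i = - 1"
      using False by (rule neg_one_odd_power)
    then have "2 * coeff Q i = 0"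
      by (simp only: assms add.right_inverse mult_zero_left)
    then have "coeff Q i = 0"
      by (simp only: mult_eq_0_iff zero_neq_numeral[symmetric] simp_thms)
    then show ?thesis
      by (simp only: coeff_negA mult_zero_right)
  qed
qed

lemma negA_even_part: "negA (even_part P) = even_part P"
proof (rule negA_of_coeff)
  fix i
  have "2 * coeff (even_part P) i = coeff P i + (- 1) ^ i * coeff P i"
    by (simp only: even_part_exact coeff_add coeff_negA flip: coeff_two_mult)
  then show "2 * coeff (even_part P) i = (1 + (- 1) ^ i) * coeff P i"
    by (simp only: distrib_right mult_1)
qed

lemma negA_odd_part: "negA (odd_part_over_A P) = odd_part_over_A P"
proof (rule negA_of_coeff)
  fix i
  have "2 * coeff (odd_part_over_A P) i = coeff (2 * Av * odd_part_over_A P) (Suc i)"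
    by (simp only: mult.assoc coeff_two_mult coeff_Av_mult)
  also have "\<dots> = coeff P (Suc i) - (- 1) ^ Suc i * coeff P (Suc i)"
    by (simp only: odd_part_exact coeff_diff coeff_negA)
  also have "\<dots> = (1 + (- 1) ^ i) * coeff P (Suc i)"
    by (simp only: power_Suc distrib_right mult_1 mult_minus_left diff_minus_eq_add)
  finally show "2 * coeff (odd_part_over_A P) i = (1 + (- 1) ^ i) * coeff P (Suc i)" .
qed

end

theory Submission
  imports Defs
begin

text \<open>
  Splitting \<open>p\<^sub>n\<^sub>+\<^sub>1 = p\<^sub>n (q\<^sup>n x + A)\<close> into its even and odd parts in \<open>A\<close>, and writing
  \<open>p\<^sub>n = e\<^sub>n(A\<^sup>2) + d\<^sub>n(A\<^sup>2) A\<close>, gives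
  \<open>e\<^sub>n\<^sub>+\<^sub>1 = q\<^sup>n x e\<^sub>n + A\<^sup>2 d\<^sub>n\<close> and \<open>d\<^sub>n\<^sub>+\<^sub>1 = e\<^sub>n + q\<^sup>n x d\<^sub>n\<close>.
  The operator \<open>(x\<^sup>2 + q s) \<eta>\<^sup>2\<close> touches only \<open>s\<close>, so it commutes with multiplication by
  polynomials in \<open>x\<close>, and applying both sides to \<open>1\<close> turns these equations into recurrences for
  \<open>e\<^sub>n 1\<close> and \<open>d\<^sub>n 1\<close> (\<open>even_op_Suc\<close>, \<open>odd_op_Suc\<close>). It remains to see that \<open>T\<^sub>n\<close> and
  \<open>U\<^sub>n\<^sub>-\<^sub>1\<close>, which have the same initial values \<open>1\<close> and \<open>0\<close>, satisfy the same recurrences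
  (\<open>chebT_rec\<close>, \<open>chebU_rec\<close>).

  For this one compares coefficients of \<open>s\<^sup>k\<close>. Because
  \<open>(q;q)\<^sub>m (-q;q)\<^sub>m = (q\<^sup>2;q\<^sup>2)\<^sub>m\<close>, the defining formulas collapse to
  \<open>q\<^bsup>k\<^sup>2\<^esup> (1 - q\<^sup>n) (q\<^sup>2;q\<^sup>2)\<^bsub>n-1-k\<^esub> / ((q\<^sup>2;q\<^sup>2)\<^sub>k (q;q)\<^bsub>n-2k\<^esub>)\<close> for \<open>T\<^sub>n\<close>, \<open>n > 0\<close>, and
  \<open>q\<^bsup>k\<^sup>2\<^esup> (q\<^sup>2;q\<^sup>2)\<^bsub>n-1-k\<^esub> / ((q\<^sup>2;q\<^sup>2)\<^sub>k (q;q)\<^bsub>n-1-2k\<^esub>)\<close> for \<open>U\<^sub>n\<^sub>-\<^sub>1\<close>.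
  After division by a common factor, the recurrences become polynomial identities in \<open>q\<^sup>k\<close> and
  \<open>q\<^sup>n\<close> (\<open>coeffT_Suc\<close>, \<open>coeffU_Suc\<close>).

  The explicit sums come from the \<open>q\<close>-binomial theorem for \<open>p\<^sub>n\<close> (\<open>coeff_p_A\<close>) together with
  \<open>A\<^bsup>2k\<^esup> 1 = \<Prod>\<^bsub>j<k\<^esub> (x\<^sup>2 + q\<^bsup>2j+1\<^esup> s)\<close> (\<open>Asq_op_power_1\<close>).
\<close>

section \<open>Powers of q and q-shifted factorials\<close>

lemma qv_power_eq: "qv ^ m = Fract (monom 1 m) 1"
  by (induction m) (simp_all add: qv_def One_fract_def monom_Suc)

lemma qv_power_neq_1: "m > 0 \<Longrightarrow> qv ^ m \<noteq> 1"
  by (auto simp: qv_power_eq One_fract_def eq_fract monom_eq_1_iff)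

lemma qv_power_neq_minus_1: "qv ^ m \<noteq> - 1"
proof
  assume "qv ^ m = - 1"
  then have "monom (1::int) m = - 1"
    by (simp add: qv_power_eq One_fract_def eq_fract)
  then have "coeff (monom (1::int) m) m = coeff (- 1) m"
    by simp
  then show False
    by (cases m) simp_all
qed

lemma one_plus_qv_power_neq_0: "1 + qv ^ m \<noteq> 0"
  using qv_power_neq_minus_1[of m] by (simp add: add_eq_0_iff)

lemma one_minus_qv_power_sq_neq_0: "m > 0 \<Longrightarrow> 1 - qv ^ m * qv ^ m \<noteq> 0"
  using qv_power_neq_1[of "m + m"] by (simp add: power_add)

abbreviation qfact :: "nat \<Rightarrow> qfun" where "qfact \<equiv> qpoch qv"

abbreviation qfact_minus :: "nat \<Rightarrow> qfun" where "qfact_minus \<equiv> qpoch (- qv)"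

lemma qpoch_0 [simp]: "qpoch a 0 = 1"
  by (simp add: qpoch_def)

lemma qpoch_Suc: "qpoch a (Suc n) = qpoch a n * (1 - qv ^ n * a)"
  by (simp add: qpoch_def)

lemma qfact_Suc: "qfact (Suc n) = qfact n * (1 - qv ^ Suc n)"
  by (simp add: qpoch_Suc mult.commute)

lemma qfact_minus_Suc: "qfact_minus (Suc n) = qfact_minus n * (1 + qv ^ Suc n)"
  by (simp add: qpoch_Suc mult.commute)

lemma qfact_neq_0 [simp]: "qfact n \<noteq> 0"
proof (induction n)
  case (Suc n)
  then show ?case
    using qv_power_neq_1[of "Suc n"] by (simp only: qfact_Suc) auto
qed simp

lemma qfact_minus_neq_0 [simp]: "qfact_minus n \<noteq> 0"
proof (induction n)
  case (Suc n)
  then show ?case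
    using one_plus_qv_power_neq_0[of "Suc n"] by (simp only: qfact_minus_Suc) auto
qed simp

text \<open>
  This is \<open>(q\<^sup>2;q\<^sup>2)\<^sub>n\<close>; the factored form is the one that occurs in the formulas for \<open>T\<^sub>n\<close>
  and \<open>U\<^sub>n\<close>.
\<close>

definition qfact_sq :: "nat \<Rightarrow> qfun" where
  "qfact_sq n = qfact n * qfact_minus n"

lemma qfact_sq_0 [simp]: "qfact_sq 0 = 1"
  by (simp add: qfact_sq_def)

lemma qfact_sq_neq_0 [simp]: "qfact_sq n \<noteq> 0"
  by (simp add: qfact_sq_def)

lemma qfact_sq_Suc: "qfact_sq (Suc n) = qfact_sq n * (1 - qv ^ Suc n * qv ^ Suc n)"
  unfolding qfact_sq_def qfact_Suc qfact_minus_Suc by (simp only: algebra_simps)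

text \<open>
  Used to resolve the factor \<open>(-q\<^bsup>n-k\<^esup>;q)\<^sub>k\<close> in the denominator of \<open>T\<^sub>n\<close>: it consists of the last
  \<open>k\<close> factors of \<open>(-q;q)\<^bsub>n-1\<^esub>\<close>.
\<close>

lemma qpoch_minus_shift: "qfact_minus m * qpoch (- (qv ^ Suc m)) k = qfact_minus (m + k)"
proof (induction k)
  case (Suc k)
  have "qfact_minus m * qpoch (- (qv ^ Suc m)) (Suc k)
      = qfact_minus (m + k) * (1 + qv ^ k * qv ^ Suc m)"
    unfolding qpoch_Suc mult.assoc[symmetric] Suc by simp
  then show ?case
    by (simp only: add_Suc_right qfact_minus_Suc power_add power_Suc ac_simps)
qed simp

lemma prod_one_plus_qv_power:
  "qfact_minus k * (\<Prod>j = k + 1..k + r. 1 + qv ^ j) = qfact_minus (k + r)"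
proof (induction r)
  case (Suc r)
  then show ?case
    by (simp add: qfact_minus_Suc mult.assoc[symmetric])
qed simp

section \<open>The coefficients of the q-Chebyshev polynomials\<close>

text \<open>
  With the usual convention \<open>1 / (q;q)\<^sub>j = 0\<close> for \<open>j < 0\<close>, the ranges of summation in \<open>T\<^sub>n\<close> and
  \<open>U\<^sub>n\<close> take care of themselves. The two arguments stand for the index \<open>n - m\<close>, which as a natural
  number could not become negative.
\<close>

definition inv_qfact :: "nat \<Rightarrow> nat \<Rightarrow> qfun" where
  "inv_qfact n m = (if m \<le> n then 1 / qfact (n - m) else 0)"

text \<open>
  The convention is consistent: at \<open>r = 0\<close> the factor \<open>1 - q\<^sup>r\<close> vanishes together with
  \<open>1 / (q;q)\<^bsub>-1\<^esub>\<close>. The recurrences for \<open>2 k < n\<close> thus extend to the boundary \<open>2 k = n\<close>.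
\<close>

lemma inv_qfact_Suc: "inv_qfact (m + r) (Suc m) = (1 - qv ^ r) * inv_qfact (m + r) m"
proof (cases r)
  case 0
  then show ?thesis by (simp add: inv_qfact_def)
next
  case (Suc r')
  have "1 - qv ^ Suc r' \<noteq> 0"
    using qv_power_neq_1[of "Suc r'"] by (simp del: power_Suc)
  then show ?thesis
    using Suc by (simp add: inv_qfact_def qfact_Suc del: power_Suc)
qed

lemma inv_qfact_Suc_Suc [simp]: "inv_qfact (Suc n) (Suc m) = inv_qfact n m"
  by (simp add: inv_qfact_def)

text \<open>
  The scalars in front of \<open>s\<^sup>k\<close> in \<open>T\<^sub>n\<close> and in \<open>U\<^sub>n\<^sub>-\<^sub>1\<close>. The index of \<open>U\<close> is shifted so that
  \<open>U\<^sub>-\<^sub>1 = 0\<close> is covered by natural numbers. At \<open>n = 0\<close> the factor \<open>1 - q\<^sup>n\<close> would give \<open>0\<close>, whereas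
  \<open>T\<^sub>0 = 1\<close>.
\<close>

definition coeffT :: "nat \<Rightarrow> nat \<Rightarrow> qfun" where
  "coeffT n k = (if n = 0 then (if k = 0 then 1 else 0) else
     qv ^ (k\<^sup>2) * (1 - qv ^ n) * qfact_sq (n - 1 - k) / qfact_sq k * inv_qfact n (2 * k))"

definition coeffU :: "nat \<Rightarrow> nat \<Rightarrow> qfun" where
  "coeffU n k = qv ^ (k\<^sup>2) * qfact_sq (n - 1 - k) / qfact_sq k * inv_qfact n (2 * k + 1)"

lemma coeffT_eq:
  assumes "n > 0" "2 * k \<le> n"
  shows "qv ^ (k\<^sup>2) * (qbracket n / qbracket (n - k)) * qbinom (n - k) k *
     (qpoch (- qv) (n - 1) / (qpoch (- qv) k * qpoch (- (qv ^ (n - k))) k)) = coeffT n k"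
proof -
  define m where "m = n - 1 - k"
  have n: "n = Suc m + k" "n - k = Suc m" "n - 1 = m + k" "n - k - k = n - 2 * k"
    using assms by (auto simp: m_def)
  have k: "k \<le> Suc m"
    using assms n by linarith
  have nz: "1 - qv ^ Suc m \<noteq> 0" "1 - qv \<noteq> 0"
    using qv_power_neq_1[of "Suc m"] qv_power_neq_1[of 1] by (simp_all del: power_Suc)
  have "qpoch (- (qv ^ Suc m)) k = qfact_minus (m + k) / qfact_minus m"
    using qpoch_minus_shift[of m k] by (simp add: field_simps)
  then have 1: "qpoch (- qv) (n - 1) / (qpoch (- qv) k * qpoch (- (qv ^ (n - k))) k)
      = qfact_minus m / qfact_minus k"
    by (simp add: n)
  have 2: "qbracket n / qbracket (n - k) * qbinom (n - k) k
     = (1 - qv ^ n) * qfact m / qfact k / qfact (n - 2 * k)"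
    using nz k unfolding qbracket_def qbinom_def n(4) unfolding n(2)
    by (simp add: qfact_Suc del: power_Suc)
  have "qv ^ (k\<^sup>2) * (qbracket n / qbracket (n - k)) * qbinom (n - k) k *
     (qpoch (- qv) (n - 1) / (qpoch (- qv) k * qpoch (- (qv ^ (n - k))) k))
     = qv ^ (k\<^sup>2) * (qbracket n / qbracket (n - k) * qbinom (n - k) k) *
       (qfact_minus m / qfact_minus k)"
    unfolding 1 by (simp only: mult.assoc)
  also have "\<dots> = coeffT n k"
    unfolding 2 using assms by (simp add: coeffT_def inv_qfact_def qfact_sq_def m_def ac_simps)
  finally show ?thesis .
qed

lemma coeffU_eq:
  assumes "2 * k \<le> n"
  shows "qv ^ (k\<^sup>2) * qbinom (n - k) k * (\<Prod>j = k + 1..n - k. 1 + qv ^ j) = coeffU (Suc n) k"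
proof -
  have "qfact_minus k * (\<Prod>j = k + 1..n - k. 1 + qv ^ j) = qfact_minus (n - k)"
    using prod_one_plus_qv_power[of k "n - 2 * k"] assms by (simp add: mult_2)
  then have "(\<Prod>j = k + 1..n - k. 1 + qv ^ j) = qfact_minus (n - k) / qfact_minus k"
    by (simp add: field_simps)
  moreover have "k \<le> n - k" "n - k - k = n - 2 * k"
    using assms by auto
  ultimately show ?thesis
    using assms by (simp add: coeffU_def inv_qfact_def qfact_sq_def qbinom_def ac_simps)
qed

lemma coeffT_eq_0: "n < 2 * k \<Longrightarrow> coeffT n k = 0"
  by (simp add: coeffT_def inv_qfact_def)

lemma coeffU_eq_0: "n \<le> 2 * k \<Longrightarrow> coeffU n k = 0"
  by (simp add: coeffU_def inv_qfact_def)

text \<open>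
  For \<open>0 < n\<close> and \<open>2 k \<le> n\<close>, with \<open>r = n - 2 k\<close>, all three terms are multiples of one scalar, and
  what is left is \<open>1 - q\<^bsup>2(n-k)\<^esup> = (1 - q\<^sup>n) + q\<^sup>n (1 - q\<^sup>r)\<close>.
\<close>

lemma coeffU_Suc: "coeffU (Suc n) k = coeffT n k + qv ^ n * coeffU n k"
proof -
  consider "n < 2 * k" | "n = 0" "k = 0" | "n > 0" "2 * k \<le> n"
    by linarith
  then show ?thesis
  proof cases
    case 1
    then show ?thesis by (simp add: coeffT_eq_0 coeffU_eq_0)
  next
    case 2
    then show ?thesis by (simp add: coeffT_def coeffU_def inv_qfact_def)
  next
    case 3
    define r where "r = n - 2 * k"
    define m where "m = n - 1 - k"
    have n: "n = 2 * k + r" "n - k = Suc m" "Suc m = k + r"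
      using 3 by (auto simp: r_def m_def)
    define c where "c = qv ^ (k\<^sup>2) * qfact_sq m / qfact_sq k * inv_qfact n (2 * k)"
    have "coeffU (Suc n) k = c * (1 - qv ^ (k + r) * qv ^ (k + r))"
      unfolding coeffU_def c_def by (simp add: n(2) qfact_sq_Suc del: power_Suc)
        (simp add: n(3) del: power_Suc)
    moreover have "coeffT n k = c * (1 - qv ^ n)"
      using 3 by (simp add: coeffT_def c_def m_def)
    moreover have "coeffU n k = c * (1 - qv ^ r)"
      using inv_qfact_Suc[of "2 * k" r] by (simp add: coeffU_def c_def m_def n(1)[symmetric])
    ultimately show ?thesis
      by (simp only: n(1) power_add mult_2 mult_2_right left_diff_distrib right_diff_distrib
          mult_1_right ac_simps)
  qed
qed

text \<open>
  The last two terms come from the summands \<open>x\<^sup>2\<close> and \<open>q s\<close> of \<open>(x\<^sup>2 + q s) \<eta>\<^sup>2\<close>. As before, for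
  \<open>0 < n\<close> and \<open>2 k \<le> n\<close> a common scalar can be divided out. With \<open>Q = q\<^sup>n\<close>, \<open>K = q\<^bsup>2k\<^esup>\<close> and
  \<open>R = Q / K\<close> there remains
  \<open>(1 - q Q) (1 - Q R) = Q (1 - Q) (1 - q R) + K (1 - q R) (1 - R) + (1 - K) (1 - Q R)\<close>;
  the first two terms on the right add up to \<open>(1 - q R) (K - Q\<^sup>2) = (K - q Q) (1 - Q R)\<close>.
  At \<open>n + 1 = 2 k\<close> only the last term survives, and it is treated separately because
  \<open>n - 1 - k\<close> may be negative there.
\<close>

lemma coeffT_Suc:
  "coeffT (Suc n) k = qv ^ n * coeffT n k + qv ^ (2 * k) * coeffU n k
     + (if k = 0 then 0 else qv ^ (2 * k - 1) * coeffU n (k - 1))"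
proof -
  have qsq: "qv ^ (k\<^sup>2) = qv ^ (2 * k - 1) * qv ^ ((k - 1)\<^sup>2)" if "k > 0"
  proof -
    have "k\<^sup>2 = (2 * k - 1) + (k - 1)\<^sup>2"
      using \<open>k > 0\<close> by (cases k) (simp_all add: power2_eq_square)
    then show ?thesis by (simp only: power_add)
  qed
  consider "Suc n < 2 * k" | "n = 0" "k = 0" | "Suc n = 2 * k" | "n > 0" "2 * k \<le> n"
    by linarith
  then show ?thesis
  proof cases
    case 1
    then show ?thesis by (simp add: coeffT_eq_0 coeffU_eq_0)
  next
    case 2
    then show ?thesis
      using qv_power_neq_1[of 1] by (simp add: coeffT_def coeffU_def inv_qfact_def qfact_Suc)
  next
    case 3
    then obtain j where j: "k = Suc j" "n = Suc (2 * j)" by (cases k) auto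
    have "1 - qv ^ Suc j * qv ^ Suc j \<noteq> 0"
      by (rule one_minus_qv_power_sq_neq_0) simp
    moreover have "qv ^ Suc (Suc (2 * j)) = qv ^ Suc j * qv ^ Suc j"
      by (simp only: mult_2 add_Suc_right flip: power_add) simp
    moreover have "Suc (Suc (2 * j)) - 1 - Suc j = j" "inv_qfact (Suc n) (2 * k) = 1"
      by (simp_all add: inv_qfact_def j)
    ultimately have "coeffT (Suc n) k = qv ^ (k\<^sup>2)"
      unfolding coeffT_def j by (simp add: qfact_sq_Suc del: power_Suc)
    moreover have "coeffU n j = qv ^ (j\<^sup>2)"
      by (simp add: coeffU_def inv_qfact_def j mult_2)
    ultimately show ?thesis
      using qsq by (simp add: j coeffT_eq_0 coeffU_eq_0)
  next
    case 4
    define r where "r = n - 2 * k"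
    define m where "m = n - 1 - k"
    have n: "n = 2 * k + r" "n - k = Suc m" "Suc m = k + r"
      using 4 by (auto simp: r_def m_def)
    define c where "c = qv ^ (k\<^sup>2) * qfact_sq m / qfact_sq k * inv_qfact (Suc n) (2 * k)"
    have i1: "inv_qfact n (2 * k) = (1 - qv ^ Suc r) * inv_qfact (Suc n) (2 * k)"
      using inv_qfact_Suc[of "2 * k" "Suc r"] by (simp add: n(1) del: power_Suc)
    have i2: "inv_qfact n (Suc (2 * k)) = (1 - qv ^ r) * inv_qfact n (2 * k)"
      using inv_qfact_Suc[of "2 * k" r] by (simp add: n(1) del: power_Suc)
    have T': "coeffT (Suc n) k = c * ((1 - qv ^ Suc n) * (1 - qv ^ (k + r) * qv ^ (k + r)))"
      unfolding coeffT_def c_def by (simp add: n(2) qfact_sq_Suc del: power_Suc)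
        (simp add: n(3) del: power_Suc)
    have T: "coeffT n k = c * ((1 - qv ^ n) * (1 - qv ^ Suc r))"
      using 4 by (simp add: coeffT_def c_def m_def i1 del: power_Suc)
    have U: "coeffU n k = c * ((1 - qv ^ Suc r) * (1 - qv ^ r))"
      by (simp add: coeffU_def c_def m_def i1 i2 del: power_Suc)
    have U': "(if k = 0 then 0 else qv ^ (2 * k - 1) * coeffU n (k - 1))
       = c * ((1 - qv ^ k * qv ^ k) * (1 - qv ^ (k + r) * qv ^ (k + r)))"
    proof (cases k)
      case (Suc j)
      have nj: "n - 1 - j = Suc m"
        using n(2) Suc by auto
      have "1 - qv ^ Suc j * qv ^ Suc j \<noteq> 0"
        by (rule one_minus_qv_power_sq_neq_0) simp
      then have E_k: "1 / qfact_sq j = (1 - qv ^ k * qv ^ k) / qfact_sq k"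
        by (simp add: Suc qfact_sq_Suc del: power_Suc)
      have i: "inv_qfact n (2 * j + 1) = inv_qfact (Suc n) (2 * k)"
        by (simp add: Suc)
      have E: "qfact_sq (n - 1 - j) = qfact_sq m * (1 - qv ^ (k + r) * qv ^ (k + r))"
        using qfact_sq_Suc[of m] by (simp only: nj n(3))
      have "qv ^ (2 * k - 1) * coeffU n j
          = qv ^ (2 * k - 1) * qv ^ (j\<^sup>2) * qfact_sq (n - 1 - j) * (1 / qfact_sq j)
            * inv_qfact n (2 * j + 1)"
        by (simp add: coeffU_def)
      also have "qv ^ (2 * k - 1) * qv ^ (j\<^sup>2) = qv ^ (k\<^sup>2)"
        using qsq by (simp only: Suc diff_Suc_1 zero_less_Suc)
      finally have "qv ^ (2 * k - 1) * coeffU n j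
          = c * ((1 - qv ^ k * qv ^ k) * (1 - qv ^ (k + r) * qv ^ (k + r)))"
        unfolding E E_k i c_def by (simp only: divide_inverse ac_simps)
      then show ?thesis
        by (simp only: Suc diff_Suc_1 nat.distinct if_False)
    qed simp
    \<comment> \<open>Here \<open>a = q\<^sup>k\<close> and \<open>b = q\<^sup>r\<close>, so that \<open>K = a\<^sup>2\<close>, \<open>Q = a\<^sup>2 b\<close> and \<open>R = b\<close>.\<close>
    have "(1 - q * (a * a * b)) * (1 - a * b * (a * b))
        = a * a * b * ((1 - a * a * b) * (1 - q * b)) + a * a * ((1 - q * b) * (1 - b))
          + (1 - a * a) * (1 - a * b * (a * b))" for a b q :: qfun
      by algebra
    from this[of qv "qv ^ k" "qv ^ r"]
    have "(1 - qv ^ Suc n) * (1 - qv ^ (k + r) * qv ^ (k + r))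
        = qv ^ n * ((1 - qv ^ n) * (1 - qv ^ Suc r))
          + qv ^ (2 * k) * ((1 - qv ^ Suc r) * (1 - qv ^ r))
          + (1 - qv ^ k * qv ^ k) * (1 - qv ^ (k + r) * qv ^ (k + r))"
      by (simp only: n(1) power_Suc power_add mult_2)
    then show ?thesis
      unfolding T' T U U' by (simp only: distrib_left mult.left_commute[of c])
  qed
qed

section \<open>Recurrences for the q-Chebyshev polynomials\<close>

lemma cst_sv_xv_eq: "cst c * sv ^ k * xv ^ m = monom (monom c m) k"
proof -
  have "xv ^ m = [:monom 1 m:]"
    by (induction m) (simp_all add: xv_def monom_Suc flip: one_pCons)
  moreover have "sv ^ k = monom 1 k"
    by (induction k) (simp_all add: sv_def monom_Suc monom_0 flip: one_pCons)
  ultimately show ?thesis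
    by (simp add: cst_def smult_monom mult.commute)
qed

lemma coeff_chebT: "coeff (chebT n) k = monom (coeffT n k) (n - 2 * k)"
proof (cases "n = 0")
  case False
  then have "chebT n = (\<Sum>k = 0..n div 2. monom (monom (coeffT n k) (n - 2 * k)) k)"
    unfolding chebT_def cst_sv_xv_eq by (simp only: if_False) (intro sum.cong refl, subst coeffT_eq, auto)
  then show ?thesis
    by (simp add: coeff_sum coeffT_eq_0 sum.delta')
qed (simp add: chebT_def coeffT_def coeff_1)

lemma coeff_chebU: "coeff (chebU (int n - 1)) k = monom (coeffU n k) (n - 1 - 2 * k)"
proof (cases n)
  case (Suc m)
  then have "chebU (int n - 1) = (\<Sum>k = 0..m div 2. monom (monom (coeffU n k) (m - 2 * k)) k)"
    unfolding chebU_def cst_sv_xv_eq by (auto intro!: sum.cong simp: coeffU_eq[simplified])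
  then show ?thesis
    by (simp add: coeff_sum coeffU_eq_0 sum.delta' Suc)
qed (simp add: chebU_def coeffU_def inv_qfact_def)

lemma coeff_eta: "coeff (eta f) k = smult (qv ^ k) (coeff f k)"
proof -
  have "eta f = pcompose f [:0, [:qv:]:]"
    by (simp add: eta_def cst_def sv_def)
  moreover have "[:qv:] ^ k = [:qv ^ k:]"
    by (induction k) (simp_all add: one_pCons)
  ultimately show ?thesis
    by (simp add: coeff_pcompose_linear)
qed

lemma coeff_Asq_op:
  "coeff (Asq_op f) k = smult (qv ^ (2 * k)) (monom 1 2 * coeff f k)
     + (if k = 0 then 0 else smult (qv ^ (2 * k - 1)) (coeff f (k - 1)))"
proof -
  have "xv\<^sup>2 = [:monom 1 2:]"
    by (simp add: xv_def power2_eq_square monom_Suc numeral_2_eq_2)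
  then have "Asq_op f = smult (monom 1 2) (eta (eta f)) + pCons 0 (smult [:qv:] (eta (eta f)))"
    by (simp add: Asq_op_def cst_def sv_def distrib_right)
  moreover have "coeff (eta (eta f)) j = smult (qv ^ (2 * j)) (coeff f j)" for j
    by (simp add: coeff_eta mult_2 power_add)
  ultimately show ?thesis
    by (cases k) (simp_all add: mult.commute[of qv])
qed

lemma chebU_rec: "chebU (int n) = chebT n + smult (monom (qv ^ n) 1) (chebU (int n - 1))"
proof (rule poly_eqI)
  fix k
  have "chebU (int n) = chebU (int (Suc n) - 1)" by simp
  moreover have "monom (qv ^ n) 1 * monom (coeffU n k) (n - 1 - 2 * k)
      = monom (qv ^ n * coeffU n k) (n - 2 * k)"
    by (cases "2 * k < n") (simp_all add: mult_monom coeffU_eq_0 Suc_diff_Suc)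
  ultimately show "coeff (chebU (int n)) k
      = coeff (chebT n + smult (monom (qv ^ n) 1) (chebU (int n - 1))) k"
    by (simp only: coeff_add coeff_smult coeff_chebT coeff_chebU coeffU_Suc add_monom) simp
qed

lemma chebT_rec: "chebT (Suc n) = smult (monom (qv ^ n) 1) (chebT n) + Asq_op (chebU (int n - 1))"
proof (rule poly_eqI)
  fix k
  have 1: "monom (qv ^ n) 1 * monom (coeffT n k) (n - 2 * k)
      = monom (qv ^ n * coeffT n k) (Suc n - 2 * k)"
    by (cases "2 * k \<le> n") (simp_all add: mult_monom coeffT_eq_0 Suc_diff_le)
  have 2: "monom 1 2 * monom (coeffU n k) (n - 1 - 2 * k) = monom (coeffU n k) (Suc n - 2 * k)"
  proof (cases "2 * k < n")
    case True
    then have "2 + (n - 1 - 2 * k) = Suc n - 2 * k" by linarith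
    then show ?thesis by (simp only: mult_monom mult_1)
  qed (simp add: coeffU_eq_0)
  have 3: "monom (coeffU n (k - 1)) (n - 1 - 2 * (k - 1)) = monom (coeffU n (k - 1)) (Suc n - 2 * k)"
    if "k > 0"
    using that by (cases k) simp_all
  show "coeff (chebT (Suc n)) k
      = coeff (smult (monom (qv ^ n) 1) (chebT n) + Asq_op (chebU (int n - 1))) k"
    unfolding coeff_add coeff_smult coeff_chebT coeff_Asq_op coeff_chebU 1 2 coeffT_Suc
    using 3 by (simp add: smult_monom add_monom)
qed

section \<open>Polynomials in A as operators\<close>

lemma coeff_in_Asq:
  assumes "negA P = P"
  shows "coeff (in_Asq P) i = coeff P (2 * i)"
proof -
  have "pcompose (in_Asq P) (Av\<^sup>2) = P"
    unfolding in_Asq_def by (rule theI'[OF in_Asq_unique[OF assms]])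
  then show ?thesis
    using coeff_pcompose_Asq[of "in_Asq P" "2 * i"] by simp
qed

lemma coeff_in_Asq_even_part: "coeff (in_Asq (even_part P)) i = coeff P (2 * i)"
proof -
  have "2 * coeff (even_part P) (2 * i) = 2 * coeff P (2 * i)"
    by (simp only: even_part_exact coeff_add coeff_negA flip: coeff_two_mult) (simp add: coeff_two_mult)
  then show ?thesis
    by (simp add: coeff_in_Asq negA_even_part)
qed

lemma coeff_in_Asq_odd_part: "coeff (in_Asq (odd_part_over_A P)) i = coeff P (2 * i + 1)"
proof -
  have "2 * coeff (odd_part_over_A P) (2 * i) = coeff (2 * Av * odd_part_over_A P) (Suc (2 * i))"
    by (simp only: mult.assoc coeff_two_mult coeff_Av_mult)
  also have "\<dots> = 2 * coeff P (2 * i + 1)"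
    by (simp only: odd_part_exact coeff_diff coeff_negA) simp
  finally show ?thesis
    by (simp add: coeff_in_Asq negA_odd_part)
qed

lemma even_odd_decomposition:
  "P = pcompose (in_Asq (even_part P)) (Av\<^sup>2) + pcompose (in_Asq (odd_part_over_A P)) (Av\<^sup>2) * Av"
    (is "_ = ?e + ?d * _")
proof (rule poly_eqI)
  fix i
  have "coeff (?d * Av) i = (if odd i then coeff P i else 0)"
    by (cases i) (auto simp: Av_def coeff_pcompose_Asq[unfolded Av_def] coeff_in_Asq_odd_part)
  then show "coeff P i = coeff (?e + ?d * Av) i"
    by (simp add: coeff_pcompose_Asq coeff_in_Asq_even_part)
qed

lemma Asq_op_add: "Asq_op (f + g) = Asq_op f + Asq_op g"
  by (simp add: Asq_op_def eta_def pcompose_add distrib_left)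

text \<open>
  The scalar \<open>c\<close> is any polynomial in \<open>x\<close>: the operator acts on \<open>s\<close> only.
\<close>

lemma Asq_op_smult: "Asq_op (smult c f) = smult c (Asq_op f)"
  by (simp add: Asq_op_def eta_def pcompose_smult)

text \<open>
  A bound of summation independent of the degree makes linearity in \<open>r\<close> visible.
\<close>

lemma op_of_extend:
  assumes "degree r \<le> N"
  shows "op_of r f = (\<Sum>i\<le>N. smult (coeff r i) ((Asq_op ^^ i) f))"
  unfolding op_of_def using assms by (intro sum.mono_neutral_left) (auto simp: coeff_eq_0)

lemma smult_sum_right: "smult c (sum g S) = (\<Sum>i\<in>S. smult c (g i))"
  by (induction S rule: infinite_finite_induct) (simp_all add: smult_add_right)

lemma op_of_add: "op_of (r + r') f = op_of r f + op_of r' f"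
proof -
  define N where "N = max (degree r) (degree r')"
  have "degree r \<le> N" "degree r' \<le> N" "degree (r + r') \<le> N"
    by (auto simp: N_def degree_add_le)
  then show ?thesis
    by (simp add: op_of_extend[of _ N] smult_add_left sum.distrib)
qed

lemma op_of_smult: "op_of (smult c r) f = smult c (op_of r f)"
proof -
  have "degree (smult c r) \<le> degree r"
    by (rule degree_smult_le)
  then show ?thesis
    by (simp add: op_of_extend[of _ "degree r"] smult_sum_right)
qed

text \<open>
  Multiplication by \<open>A\<^sup>2\<close>, the outer variable of \<open>r\<close>, becomes composition with the operator. The
  coefficients of \<open>r\<close> can be moved past it because they involve only \<open>x\<close>.
\<close>

lemma op_of_pCons_0: "op_of (pCons 0 r) f = Asq_op (op_of r f)"
proof -
  have "Asq_op 0 = 0"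
    by (simp add: Asq_op_def eta_def)
  then have sum: "Asq_op (\<Sum>i\<in>S. g i) = (\<Sum>i\<in>S. Asq_op (g i))" for g and S :: "nat set"
    by (induction S rule: infinite_finite_induct) (simp_all add: Asq_op_add)
  have "op_of (pCons 0 r) f
      = (\<Sum>i\<le>Suc (degree r). smult (coeff (pCons 0 r) i) ((Asq_op ^^ i) f))"
    by (rule op_of_extend) (simp add: degree_pCons_le)
  then show ?thesis
    by (simp add: sum.atMost_Suc_shift op_of_def sum Asq_op_smult del: sum.atMost_Suc)
qed

text \<open>
  Since \<open>\<eta>\<close> is multiplicative, \<open>\<eta>\<^sup>2\<close> shifts the \<open>j\<close>-th factor to the \<open>(j+1)\<close>-th one, and
  \<open>x\<^sup>2 + q s\<close> supplies the missing factor at \<open>j = 0\<close>.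
\<close>

lemma Asq_op_power_1: "(Asq_op ^^ k) 1 = (\<Prod>j<k. xv\<^sup>2 + cst (qv ^ (2 * j + 1)) * sv)"
proof (induction k)
  case (Suc k)
  have eta_mult: "eta (f * g) = eta f * eta g" for f g
    by (simp add: eta_def pcompose_mult)
  have eta_prod: "eta (prod g S) = (\<Prod>j\<in>S. eta (g j))" for g and S :: "nat set"
    by (induction S rule: infinite_finite_induct) (simp_all add: eta_mult, simp_all add: eta_def pcompose_1)
  have "eta (xv\<^sup>2 + cst c * sv) = xv\<^sup>2 + cst (qv * c) * sv" for c
    by (simp add: eta_def xv_def cst_def sv_def power2_eq_square pcompose_pCons mult.commute)
  then show ?case
    unfolding funpow.simps o_apply Suc
    by (simp add: Asq_op_def eta_prod prod.lessThan_Suc_shift del: prod.lessThan_Suc)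
qed simp

section \<open>The q-binomial theorem for the product\<close>

lemma qbinom_0 [simp]: "qbinom n 0 = 1"
  by (simp add: qbinom_def)

lemma qbinom_eq_0: "n < k \<Longrightarrow> qbinom n k = 0"
  by (simp add: qbinom_def)

lemma qbinom_Suc_Suc: "qbinom (Suc n) (Suc k) = qv ^ Suc k * qbinom n (Suc k) + qbinom n k"
proof -
  consider "n < k" | "n = k" | r where "n = Suc (k + r)"
    by (metis less_imp_Suc_add linorder_neqE_nat)
  then show ?thesis
  proof cases
    case 3
    have nz: "1 - qv ^ Suc k \<noteq> 0" "1 - qv ^ Suc r \<noteq> 0"
      using qv_power_neq_1[of "Suc k"] qv_power_neq_1[of "Suc r"] by (simp_all del: power_Suc)
    define c where "c = qfact n / (qfact (Suc k) * qfact (Suc r))"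
    have "qbinom (Suc n) (Suc k) = c * (1 - qv ^ Suc n)"
      using 3 by (simp add: qbinom_def c_def qfact_Suc del: power_Suc)
    moreover have "qbinom n (Suc k) = c * (1 - qv ^ Suc r)"
      using 3 nz by (simp add: qbinom_def c_def qfact_Suc[of r] del: power_Suc)
    moreover have "qbinom n k = c * (1 - qv ^ Suc k)"
      using 3 nz by (simp add: qbinom_def c_def qfact_Suc[of k] Suc_diff_le del: power_Suc)
    moreover have "qv ^ Suc n = qv ^ Suc k * qv ^ Suc r"
      using 3 by (simp flip: power_add power_Suc)
    ultimately show ?thesis
      by (simp add: right_diff_distrib ac_simps del: power_Suc)
  qed (simp_all add: qbinom_def)
qed

lemma binom2_Suc: "binom2 (int (Suc m)) = binom2 (int m) + m"
proof -
  have "int (Suc m) * (int (Suc m) - 1) = int m * (int m - 1) + int m * 2"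
    by (simp add: algebra_simps)
  then have "int (Suc m) * (int (Suc m) - 1) div 2 = int m * (int m - 1) div 2 + int m"
    by simp
  moreover have "int m * (int m - 1) div 2 \<ge> 0"
    by (cases m) auto
  ultimately show ?thesis
    unfolding binom2_def by linarith
qed

lemma p_A_Suc: "p_A (Suc n) = smult (monom (qv ^ n) 1) (p_A n) + pCons 0 (p_A n)"
  by (simp add: p_A_def Av_def monom_Suc monom_0 distrib_left mult.commute)

text \<open>
  The \<open>q\<close>-binomial theorem, by induction with the \<open>q\<close>-Pascal rule.
\<close>

lemma coeff_p_A: "coeff (p_A n) m = monom (qv ^ binom2 (int (n - m)) * qbinom n m) (n - m)"
proof (induction n arbitrary: m)
  case 0
  then show ?case
    by (auto simp: p_A_def coeff_1 qbinom_def binom2_def)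
next
  case (Suc n)
  have step: "monom (qv ^ n) 1 * monom (qv ^ binom2 (int (n - m)) * qbinom n m) (n - m)
      = monom (qv ^ binom2 (int (Suc n - m)) * (qv ^ m * qbinom n m)) (Suc n - m)"
  proof (cases "m \<le> n")
    case True
    then have "binom2 (int (Suc n - m)) + m = n + binom2 (int (n - m))"
      using binom2_Suc[of "n - m"] by (simp add: Suc_diff_le)
    then have "qv ^ n * qv ^ binom2 (int (n - m)) = qv ^ binom2 (int (Suc n - m)) * qv ^ m"
      by (metis power_add)
    then show ?thesis
      using True by (simp add: mult_monom Suc_diff_le mult.assoc[symmetric])
  qed (simp add: qbinom_eq_0)
  show ?case
  proof (cases m)
    case 0
    then show ?thesis
      using step by (simp add: p_A_Suc Suc)
  next
    case m: (Suc m')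
    show ?thesis
      using step unfolding p_A_Suc coeff_add coeff_smult Suc.IH
      by (simp add: m Suc.IH qbinom_Suc_Suc add_monom distrib_left del: power_Suc)
  qed
qed

section \<open>The operator identity\<close>

abbreviation even_op :: "nat \<Rightarrow> xs_poly" where
  "even_op n \<equiv> op_of (in_Asq (even_part (p_A n))) 1"

abbreviation odd_op :: "nat \<Rightarrow> xs_poly" where
  "odd_op n \<equiv> op_of (in_Asq (odd_part_over_A (p_A n))) 1"

lemma even_op_Suc: "even_op (Suc n) = smult (monom (qv ^ n) 1) (even_op n) + Asq_op (odd_op n)"
proof -
  have "in_Asq (even_part (p_A (Suc n))) = smult (monom (qv ^ n) 1) (in_Asq (even_part (p_A n)))
      + pCons 0 (in_Asq (odd_part_over_A (p_A n)))"
    by (rule poly_eqI)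
      (simp add: coeff_in_Asq_even_part coeff_in_Asq_odd_part p_A_Suc coeff_pCons split: nat.split)
  then show ?thesis
    by (simp add: op_of_add op_of_smult op_of_pCons_0)
qed

lemma odd_op_Suc: "odd_op (Suc n) = even_op n + smult (monom (qv ^ n) 1) (odd_op n)"
proof -
  have "in_Asq (odd_part_over_A (p_A (Suc n))) = in_Asq (even_part (p_A n))
      + smult (monom (qv ^ n) 1) (in_Asq (odd_part_over_A (p_A n)))"
    by (rule poly_eqI)
      (simp add: coeff_in_Asq_even_part coeff_in_Asq_odd_part p_A_Suc)
  then show ?thesis
    by (simp add: op_of_add op_of_smult)
qed

text \<open>
  Both pairs of sequences start with \<open>(1, 0)\<close> and obey the same recurrence.
\<close>

lemma cheb_eq_op: "chebT n = even_op n \<and> chebU (int n - 1) = odd_op n"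
proof (induction n)
  case 0
  have "in_Asq (even_part (p_A 0)) = 1" "in_Asq (odd_part_over_A (p_A 0)) = 0"
    by (rule poly_eqI; simp add: coeff_in_Asq_even_part coeff_in_Asq_odd_part p_A_def coeff_1)+
  then show ?case
    by (simp add: op_of_def chebT_def chebU_def)
next
  case (Suc n)
  then show ?case
    by (simp add: chebT_rec chebU_rec even_op_Suc odd_op_Suc)
qed

text \<open>
  The bound \<open>N\<close> is free because the two sums of the theorem run to \<open>n div 2\<close> and to
  \<open>(n + 1) div 2\<close>; the second one has a vanishing last term when \<open>n\<close> is odd.
\<close>

lemma op_of_1_explicit:
  assumes "\<And>k. coeff r k = monom (c k) (m k)" and "\<And>k. k > N \<Longrightarrow> c k = 0"
  shows "op_of r 1 = (\<Sum>k = 0..N. cst (c k) * xv ^ m k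
           * (\<Prod>j<k. xv\<^sup>2 + cst (qv ^ (2 * j + 1)) * sv))"
proof -
  have "degree r \<le> N"
    using assms by (intro degree_le) auto
  moreover have "cst (c k) * xv ^ m k = [:monom (c k) (m k):]" for k
    using cst_sv_xv_eq[of "c k" 0 "m k"] by (simp add: monom_0)
  ultimately show ?thesis
    by (simp add: op_of_extend Asq_op_power_1 assms(1) atMost_atLeast0)
qed

lemma even_op_explicit:
  "even_op n = (\<Sum>k = 0..n div 2.
     cst (qv ^ binom2 (int n - 2 * int k) * qbinom n (2 * k)) * xv ^ (n - 2 * k)
     * (\<Prod>j<k. xv\<^sup>2 + cst (qv ^ (2 * j + 1)) * sv))"
proof (rule op_of_1_explicit)
  fix k
  show "coeff (in_Asq (even_part (p_A n))) k
      = monom (qv ^ binom2 (int n - 2 * int k) * qbinom n (2 * k)) (n - 2 * k)"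
    by (cases "2 * k \<le> n") (simp_all add: coeff_in_Asq_even_part coeff_p_A qbinom_eq_0 of_nat_diff)
qed (auto simp: qbinom_eq_0)

lemma odd_op_explicit:
  "odd_op (n + 1) = (\<Sum>k = 0..(n + 1) div 2.
     cst (qv ^ binom2 (int n - 2 * int k) * qbinom (n + 1) (2 * k + 1)) * xv ^ (n - 2 * k)
     * (\<Prod>j<k. xv\<^sup>2 + cst (qv ^ (2 * j + 1)) * sv))"
proof (rule op_of_1_explicit)
  fix k
  show "coeff (in_Asq (odd_part_over_A (p_A (n + 1)))) k
      = monom (qv ^ binom2 (int n - 2 * int k) * qbinom (n + 1) (2 * k + 1)) (n - 2 * k)"
    by (cases "2 * k \<le> n") (simp_all add: coeff_in_Asq_odd_part coeff_p_A qbinom_eq_0 of_nat_diff)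
qed (auto simp: qbinom_eq_0)

theorem theorem5p4:
  fixes n :: nat
  shows "chebT n = op_of (in_Asq (even_part (p_A n))) 1
    \<and> op_of (in_Asq (even_part (p_A n))) 1 =
        (\<Sum>k = 0..n div 2.
           cst (qv ^ binom2 (int n - 2 * int k) * qbinom n (2 * k)) * xv ^ (n - 2 * k)
           * (\<Prod>j<k. xv\<^sup>2 + cst (qv ^ (2 * j + 1)) * sv))
    \<and> chebU (int n) = op_of (in_Asq (odd_part_over_A (p_A (n + 1)))) 1
    \<and> op_of (in_Asq (odd_part_over_A (p_A (n + 1)))) 1 =
        (\<Sum>k = 0..(n + 1) div 2.
           cst (qv ^ binom2 (int n - 2 * int k) * qbinom (n + 1) (2 * k + 1)) * xv ^ (n - 2 * k)
           * (\<Prod>j<k. xv\<^sup>2 + cst (qv ^ (2 * j + 1)) * sv))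
    \<and> symbolic_eq (p_A n) (chebT n) (chebU (int n - 1))"
proof -
  have "chebU (int n) = odd_op (n + 1)"
    using cheb_eq_op[of "n + 1"] by simp
  moreover have "symbolic_eq (p_A n) (chebT n) (chebU (int n - 1))"
    unfolding symbolic_eq_def using even_odd_decomposition cheb_eq_op by blast
  ultimately show ?thesis
    using cheb_eq_op even_op_explicit odd_op_explicit by blast
qed

end
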